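(* Let $(X,d)$ be a compact metric space and let $f\colon X\to X$ be a continuous map. If $f$ is chain transitive and has the s-limit shadowing property, then $f$ satisfies both of the following properties: (2) $f$ has the shadowing property along $\mathcal{D}$; (3) the map $\mathcal{D}(\cdot)\colon (X,d)\to (K(X),d_H)$ is continuous.
   Context: Let $(X,d)$ be a compact metric space and $f\colon X\to X$ a continuous map. Chains. For $\delta>0$, a finite sequence $(x_i)_{i=0}^k$ in $X$ ($k$ a positive integer) is a $\delta$-chain of $f$ if $d(f(x_i),x_{i+1})\le\delta$ for every $0\le i\le k-1$. $f$ is chain transitive if for all $x,y\in X$ and $\delta>0$ there is a $\delta$-chain $(x_i)_{i=0}^k$ of $f$ with $x_0=x$ and $x_k=y$. The relation $\sim$ (for $f$ chain transitive). A $\delta$-chain $(x_i)_{i=0}^k$ with $x_0=x_k$ is a $\delta$-cycle of length $k$. Let $m=m(\delta)>0$ be the greatest common divisor of the lengths of all $\delta$-cycles of $f$. Define $x\sim_\delta y$ iff there is a $\delta$-chain $(x_i)_{i=0}^k$ of $f$ with $x_0=x$, $x_k=y$ and $m\mid k$; this is an equivalence relation on $X$ which is open and closed in $X^2$. Define $x\sim y$ iff $x\sim_\delta y$ for every $\delta>0$; this is a closed equivalence relation on $X$. $\mathcal{D}$ denotes the set of equivalence classes of $\sim$ (each is a closed subset of $X$), and $\mathcal{D}(x)\in\mathcal{D}$ denotes the class containing $x$. $K(X)$ is the set of non-empty closed subsets of $X$ with the Hausdorff metric $d_H(A,B)=\inf\{\epsilon>0\colon A\subset B_\epsilon(B),\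 B\subset B_\epsilon(A)\}$, where $B_\epsilon(A)=\{x\in X\colon d(x,A)<\epsilon\}$. Shadowing along $\mathcal{D}$. For $\delta>0$, a sequence $(x_i)_{i\ge0}$ in $X$ is a $(\mathcal{D},\delta)$-pseudo orbit of $f$ if $f(x_i)\sim x_{i+1}$ and $d(f(x_i),x_{i+1})\le\delta$ for all $i\ge0$. $f$ has the shadowing property along $\mathcal{D}$ if for every $\epsilon>0$ there is $\delta>0$ such that for every $(\mathcal{D},\delta)$-pseudo orbit $(x_i)_{i\ge0}$ of $f$ there is $x\in X$ with $x_0\sim x$ and $d(f^i(x),x_i)\le\epsilon$ for all $i\ge0$. s-limit shadowing. For $\delta>0$, a sequence $(x_i)_{i\ge0}$ in $X$ is a $\delta$-limit-pseudo orbit of $f$ if $d(f(x_i),x_{i+1})\le\delta$ for all $i\ge0$ and $\lim_{i\to\infty}d(f(x_i),x_{i+1})=0$. It is $\epsilon$-limit shadowed by $x\in X$ if $d(f^i(x),x_i)\le\epsilon$ for all $i\ge0$ and $\lim_{i\to\infty}d(f^i(x),x_i)=0$. $f$ has the s-limit shadowing property if for every $\epsilon>0$ there is $\delta>0$ such that every $\delta$-limit-pseudo orbit of $f$ is $\epsilon$-limit shadowed by some point of $X$. *)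

theory Defs
  imports "HOL-Analysis.Analysis"
begin

text \<open>
  Throughout, the space is a subset \<open>X\<close> of a metric space type, with the induced metric, and
  \<open>f\<close> is a self-map of \<open>X\<close>; its values outside \<open>X\<close> are irrelevant. A finite sequence
  \<open>x\<^sub>0, \<dots>, x\<^sub>k\<close> is given by a function on \<^typ>\<open>nat\<close>, of which only the values up to \<open>k\<close> matter.
\<close>

definition delta_chain :: "'a::metric_space set \<Rightarrow> ('a \<Rightarrow> 'a) \<Rightarrow> real \<Rightarrow> nat \<Rightarrow> (nat \<Rightarrow> 'a) \<Rightarrow> bool"
  where "delta_chain X f \<delta> k x \<longleftrightarrow>
    k > 0 \<and> (\<forall>i\<le>k. x i \<in> X) \<and> (\<forall>i<k. dist (f (x i)) (x (Suc i)) \<le> \<delta>)"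

definition chain_transitive :: "'a::metric_space set \<Rightarrow> ('a \<Rightarrow> 'a) \<Rightarrow> bool"
  where "chain_transitive X f \<longleftrightarrow>
    (\<forall>x\<in>X. \<forall>y\<in>X. \<forall>\<delta>>0. \<exists>k z. delta_chain X f \<delta> k z \<and> z 0 = x \<and> z k = y)"

definition delta_cycle :: "'a::metric_space set \<Rightarrow> ('a \<Rightarrow> 'a) \<Rightarrow> real \<Rightarrow> nat \<Rightarrow> (nat \<Rightarrow> 'a) \<Rightarrow> bool"
  where "delta_cycle X f \<delta> k x \<longleftrightarrow> delta_chain X f \<delta> k x \<and> x 0 = x k"

definition cycle_gcd :: "'a::metric_space set \<Rightarrow> ('a \<Rightarrow> 'a) \<Rightarrow> real \<Rightarrow> nat"
  where "cycle_gcd X f \<delta> = Gcd {k. \<exists>x. delta_cycle X f \<delta> k x}"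

definition chain_rel_delta :: "'a::metric_space set \<Rightarrow> ('a \<Rightarrow> 'a) \<Rightarrow> real \<Rightarrow> ('a \<times> 'a) set"
  where "chain_rel_delta X f \<delta> =
    {(x, y). \<exists>k z. delta_chain X f \<delta> k z \<and> z 0 = x \<and> z k = y \<and> cycle_gcd X f \<delta> dvd k}"

definition chain_rel :: "'a::metric_space set \<Rightarrow> ('a \<Rightarrow> 'a) \<Rightarrow> ('a \<times> 'a) set"
  where "chain_rel X f = {(x, y). \<forall>\<delta>>0. (x, y) \<in> chain_rel_delta X f \<delta>}"

definition chain_class :: "'a::metric_space set \<Rightarrow> ('a \<Rightarrow> 'a) \<Rightarrow> 'a \<Rightarrow> 'a set"
  where "chain_class X f x = chain_rel X f `` {x}"

definition class_pseudo_orbit :: "'a::metric_space set \<Rightarrow> ('a \<Rightarrow> 'a) \<Rightarrow> real \<Rightarrow> (nat \<Rightarrow> 'a) \<Rightarrow> bool"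
  where "class_pseudo_orbit X f \<delta> x \<longleftrightarrow>
    (\<forall>i. x i \<in> X \<and> (f (x i), x (Suc i)) \<in> chain_rel X f \<and> dist (f (x i)) (x (Suc i)) \<le> \<delta>)"

definition shadowing_along_classes :: "'a::metric_space set \<Rightarrow> ('a \<Rightarrow> 'a) \<Rightarrow> bool"
  where "shadowing_along_classes X f \<longleftrightarrow>
    (\<forall>\<epsilon>>0. \<exists>\<delta>>0. \<forall>x. class_pseudo_orbit X f \<delta> x \<longrightarrow>
      (\<exists>p\<in>X. (x 0, p) \<in> chain_rel X f \<and> (\<forall>i. dist ((f ^^ i) p) (x i) \<le> \<epsilon>)))"

definition limit_pseudo_orbit :: "'a::metric_space set \<Rightarrow> ('a \<Rightarrow> 'a) \<Rightarrow> real \<Rightarrow> (nat \<Rightarrow> 'a) \<Rightarrow> bool"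
  where "limit_pseudo_orbit X f \<delta> x \<longleftrightarrow>
    (\<forall>i. x i \<in> X) \<and> (\<forall>i. dist (f (x i)) (x (Suc i)) \<le> \<delta>) \<and>
    (\<lambda>i. dist (f (x i)) (x (Suc i))) \<longlonglongrightarrow> 0"

definition limit_shadowed :: "('a::metric_space \<Rightarrow> 'a) \<Rightarrow> real \<Rightarrow> (nat \<Rightarrow> 'a) \<Rightarrow> 'a \<Rightarrow> bool"
  where "limit_shadowed f \<epsilon> x p \<longleftrightarrow>
    (\<forall>i. dist ((f ^^ i) p) (x i) \<le> \<epsilon>) \<and> (\<lambda>i. dist ((f ^^ i) p) (x i)) \<longlonglongrightarrow> 0"

definition s_limit_shadowing :: "'a::metric_space set \<Rightarrow> ('a \<Rightarrow> 'a) \<Rightarrow> bool"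
  where "s_limit_shadowing X f \<longleftrightarrow>
    (\<forall>\<epsilon>>0. \<exists>\<delta>>0. \<forall>x. limit_pseudo_orbit X f \<delta> x \<longrightarrow> (\<exists>p\<in>X. limit_shadowed f \<epsilon> x p))"

definition hyperspace :: "'a::metric_space set \<Rightarrow> 'a set set"
  where "hyperspace X = {A. closedin (top_of_set X) A \<and> A \<noteq> {}}"

definition set_nbhd :: "'a::metric_space set \<Rightarrow> real \<Rightarrow> 'a set \<Rightarrow> 'a set"
  where "set_nbhd X \<epsilon> A = {x \<in> X. infdist x A < \<epsilon>}"

text \<open>
  Outside the hyperspace the infimum may range over the empty set, so the distance is set to the
  junk value 0 there; this makes it nonnegative everywhere, as \<^locale>\<open>Metric_space\<close> requires.
\<close>

definition hausdorff_dist :: "'a::metric_space set \<Rightarrow> 'a set \<Rightarrow> 'a set \<Rightarrow> real"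
  where "hausdorff_dist X A B =
    (if A \<in> hyperspace X \<and> B \<in> hyperspace X
     then Inf {\<epsilon>. \<epsilon> > 0 \<and> A \<subseteq> set_nbhd X \<epsilon> B \<and> B \<subseteq> set_nbhd X \<epsilon> A} else 0)"

lemma Metric_space_hausdorff_dist:
  fixes X :: "'a::metric_space set"
  assumes "compact X"
  shows "Metric_space (hyperspace X) (hausdorff_dist X)"
proof -
  define S where "S A B = {\<epsilon>. \<epsilon> > 0 \<and> A \<subseteq> set_nbhd X \<epsilon> B \<and> B \<subseteq> set_nbhd X \<epsilon> A}" for A B
  have H: "hausdorff_dist X A B = Inf (S A B)" if "A \<in> hyperspace X" "B \<in> hyperspace X" for A B
    using that by (simp add: hausdorff_dist_def S_def)
  have sub: "A \<subseteq> X" and ne: "A \<noteq> {}" and cl: "closed A" if "A \<in> hyperspace X" for A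
    using that closedin_subset[of "top_of_set X" A] closedin_compact[OF assms, of A]
    by (auto simp: hyperspace_def compact_imp_closed)
  have bdd: "bdd_below (S A B)" for A B
    by (rule bdd_belowI[of _ 0]) (auto simp: S_def)
  obtain D where D: "\<And>x y. x \<in> X \<Longrightarrow> y \<in> X \<Longrightarrow> dist x y \<le> D"
    using compact_imp_bounded[OF assms] bounded_two_points by metis
  have one: "A \<subseteq> set_nbhd X (\<bar>D\<bar> + 1) B" if AB: "A \<in> hyperspace X" "B \<in> hyperspace X" for A B
  proof
    fix a assume "a \<in> A"
    obtain b where b: "b \<in> B" using ne[OF AB(2)] by blast
    have "a \<in> X" "b \<in> X" using \<open>a \<in> A\<close> b sub AB by blast+
    then have "infdist a B \<le> D" using infdist_le[OF b, of a] D[of a b] by linarith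
    then show "a \<in> set_nbhd X (\<bar>D\<bar> + 1) B" using \<open>a \<in> X\<close> by (auto simp: set_nbhd_def)
  qed
  have nonempty: "S A B \<noteq> {}" if "A \<in> hyperspace X" "B \<in> hyperspace X" for A B
  proof -
    have "\<bar>D\<bar> + 1 \<in> S A B" using one that by (auto simp: S_def)
    then show ?thesis by blast
  qed
  have half: "A \<subseteq> set_nbhd X (e + e') C"
    if "A \<subseteq> set_nbhd X e B" "B \<subseteq> set_nbhd X e' C" "B \<noteq> {}" for A B C e e'
  proof
    fix a assume "a \<in> A"
    then have "a \<in> X" "infdist a B < e" using that by (auto simp: set_nbhd_def)
    then obtain b where "b \<in> B" "dist a b < e"
      using \<open>B \<noteq> {}\<close> by (auto simp: infdist_notempty cInf_less_iff)
    moreover have "infdist b C < e'" using that \<open>b \<in> B\<close> by (auto simp: set_nbhd_def)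
    ultimately show "a \<in> set_nbhd X (e + e') C"
      using infdist_triangle[of a C b] \<open>a \<in> X\<close> by (simp add: set_nbhd_def)
  qed
  have sep: "A \<subseteq> B" if AB: "A \<in> hyperspace X" "B \<in> hyperspace X" and 0: "Inf (S A B) = 0" for A B
  proof
    fix a assume "a \<in> A"
    have "infdist a B < e" if "e > 0" for e
    proof -
      obtain e' where "e' \<in> S A B" "e' < e"
        using 0 \<open>e > 0\<close> cInf_less_iff[OF nonempty[OF AB] bdd] by auto
      then show ?thesis using \<open>a \<in> A\<close> by (force simp: S_def set_nbhd_def)
    qed
    then have "infdist a B = 0" using infdist_nonneg[of a B] by (meson less_irrefl not_less_iff_gr_or_eq not_le)
    then show "a \<in> B" using in_closed_iff_infdist_zero[OF cl ne] AB by blast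
  qed
  have comm: "S A B = S B A" for A B by (auto simp: S_def)
  show ?thesis
  proof
    show "0 \<le> hausdorff_dist X A B" for A B
      using nonempty[of A B] by (auto simp: hausdorff_dist_def S_def intro!: cInf_greatest)
    show "hausdorff_dist X A B = hausdorff_dist X B A" for A B
      using comm[of A B] by (auto simp: hausdorff_dist_def S_def)
  next
    fix A B assume AB: "A \<in> hyperspace X" "B \<in> hyperspace X"
    show "hausdorff_dist X A B = 0 \<longleftrightarrow> A = B"
    proof
      assume "hausdorff_dist X A B = 0"
      then show "A = B" using sep[of A B] sep[of B A] AB H comm by auto
    next
      assume "A = B"
      have "S A A = {0<..}" using sub[OF AB(1)] by (auto simp: S_def set_nbhd_def)
      then show "hausdorff_dist X A B = 0" using H[OF AB] \<open>A = B\<close> by simp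
    qed
  next
    fix A B C assume ABC: "A \<in> hyperspace X" "B \<in> hyperspace X" "C \<in> hyperspace X"
    have *: "Inf (S A C) \<le> e + e'" if "e \<in> S A B" "e' \<in> S B C" for e e'
    proof (rule cInf_lower[OF _ bdd])
      show "e + e' \<in> S A C"
        using that half[of A e B e' C] half[of C e' B e A] ne[OF ABC(2)]
        by (auto simp: S_def add.commute)
    qed
    have "Inf (S A C) - e \<le> Inf (S B C)" if "e \<in> S A B" for e
      using *[OF that] nonempty[OF ABC(2,3)] by (intro cInf_greatest) (auto simp: algebra_simps)
    then have "Inf (S A C) - Inf (S B C) \<le> Inf (S A B)"
      using nonempty[OF ABC(1,2)] by (intro cInf_greatest) (auto simp: algebra_simps)
    then show "hausdorff_dist X A C \<le> hausdorff_dist X A B + hausdorff_dist X B C"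
      using ABC H by simp
  qed
qed

end

theory Submission
  imports Defs
begin

text \<open>
  Both properties rest on one observation: two points whose forward orbits are asymptotic lie in
  the same class. Indeed all \<open>\<delta>\<close>-chains from \<open>x\<close> to \<open>y\<close> have the same length modulo the cycle gcd
  \<open>m(\<delta>)\<close>, so \<open>x \<sim>\<^sub>\<delta> y\<close> can be tested on any one of them; it follows that \<open>f\<close> both preserves and
  reflects \<open>\<sim>\<^sub>\<delta>\<close>. As points at distance at most \<open>\<delta>/2\<close> are \<open>\<delta>\<close>-related, asymptotic
  orbits are eventually \<open>\<delta>\<close>-related, hence so are their starting points
  (\<open>asymptotic_imp_related\<close>).

  For the shadowing property along the classes, cut a pseudo orbit \<open>x\<close> at time \<open>n\<close> and continue it
  by the true orbit of \<open>x n\<close>. The result is a limit pseudo orbit that never leaves the classes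
  of the orbit of \<open>x 0\<close>, so the point that limit shadows it is related to \<open>x 0\<close>
  (\<open>limit_shadowing_along_classes\<close>). A limit of these points as \<open>n\<close> grows shadows all of \<open>x\<close>, and it
  is still related to \<open>x 0\<close> because classes are closed.

  For continuity of the class map, it must be shown that if \<open>y \<sim> x\<close> and \<open>x'\<close> is close to \<open>x\<close>, then
  some point close to \<open>y\<close> is related to \<open>x'\<close>. Here \<open>y \<sim>\<^sub>\<delta> x'\<close>, and the main point is that for
  some \<open>k\<close> there is a chain from \<open>y\<close> to \<open>f\<^sup>k(x')\<close> of length exactly \<open>k\<close> (\<open>synchronised_chain\<close>):
  all sufficiently large multiples of \<open>m\<close> occur as lengths of chains between two related points,
  since the lengths of the cycles at a point form a numerical semigroup. Following this chain and
  then the orbit of \<open>x'\<close> gives a limit pseudo orbit which starts at \<open>y\<close> and is in step with the orbit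
  of \<open>x'\<close>; the point that limit shadows it is close to \<open>y\<close> and asymptotic to \<open>x'\<close>.
\<close>

section \<open>Numerical semigroups\<close>

text \<open>
  The differences of elements of \<open>S\<close> form a subgroup of the integers; its positive generator is the
  gcd, which is therefore itself a difference.
\<close>

lemma Gcd_eq_difference:
  fixes S :: "nat set"
  assumes add: "\<And>a b. a \<in> S \<Longrightarrow> b \<in> S \<Longrightarrow> a + b \<in> S" and s: "s \<in> S" "s > 0"
  obtains a b where "a \<in> S" "b \<in> S" "a = b + Gcd S"
proof -
  define P where "P d \<longleftrightarrow> d > 0 \<and> (\<exists>a\<in>S. \<exists>b\<in>S. a = b + d)" for d
  have mult: "(Suc n) * a \<in> S" if "a \<in> S" for n a
    by (induction n) (use that add in auto)
  have "P s"
    using s add[OF s(1) s(1)] by (auto simp: P_def)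
  define d where "d = (LEAST d. P d)"
  have "P d" and least: "\<And>e. P e \<Longrightarrow> d \<le> e"
    unfolding d_def using \<open>P s\<close> by (auto intro: LeastI Least_le)
  then obtain a b where ab: "a \<in> S" "b \<in> S" "a = b + d" "d > 0"
    by (auto simp: P_def)
  have "d dvd c" if "c \<in> S" for c
  proof (rule ccontr)
    assume "\<not> d dvd c"
    then have pos: "c mod d > 0"
      by (simp add: mod_greater_zero_iff_not_dvd)
    define q where "q = c div d"
    have c: "c = q * d + c mod d"
      by (simp add: q_def)
    \<comment> \<open>The remainder of \<open>c\<close> is the difference of \<open>c + b + q b\<close> and \<open>b + q a\<close>.\<close>
    have "c + Suc q * b \<in> S"
      using add mult ab that by blast
    moreover have "b + q * a \<in> S"
      by (cases q) (use add mult ab in auto)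
    moreover have "c + Suc q * b = (b + q * a) + c mod d"
      using c ab(3) by (simp add: algebra_simps)
    ultimately have "P (c mod d)"
      using pos unfolding P_def by blast
    then show False
      using least[of "c mod d"] ab(4) mod_less_divisor[of d c] by linarith
  qed
  then have "d dvd Gcd S"
    by (auto intro: Gcd_greatest)
  moreover have "Gcd S dvd d"
    using ab dvd_add_right_iff[of "Gcd S" b d] by (metis Gcd_dvd)
  ultimately have "d = Gcd S"
    by (simp add: dvd_antisym)
  then show thesis
    using that ab by blast
qed

lemma numerical_semigroup_cofinite:
  fixes S :: "nat set"
  assumes add: "\<And>a b. a \<in> S \<Longrightarrow> b \<in> S \<Longrightarrow> a + b \<in> S" and s: "s \<in> S" "s > 0"
  obtains N where "\<And>n. n \<ge> N \<Longrightarrow> n * Gcd S \<in> S"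
proof -
  obtain a b where ab: "a \<in> S" "b \<in> S" "a = b + Gcd S"
    using Gcd_eq_difference[of S s] assms by blast
  define m where "m = Gcd S"
  have m: "m > 0"
    using Gcd_dvd[OF s(1)] s(2) by (auto simp: m_def intro!: Nat.gr0I)
  have mult: "n * c \<in> S" if "c \<in> S" "n > 0" for n c
    using that(2) by (induction n rule: nat_induct_non_zero) (use add that(1) in auto)
  \<comment> \<open>Replacing \<open>b\<close> by \<open>b + s\<close> and \<open>a\<close> by \<open>a + s\<close> makes both positive.\<close>
  obtain q where q: "b + s = q * m"
    using ab s by (metis Gcd_dvd add dvd_def m_def mult.commute)
  have q0: "q > 0"
    using q s by (cases q) auto
  have "n * m \<in> S" if n: "n \<ge> q * q + q" for n
  proof -
    define t r where "t = n div q" and "r = n mod q"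
    have nt: "n = t * q + r" and r: "r < q"
      using q0 by (simp_all add: t_def r_def)
    have "q < Suc t"
    proof (rule ccontr)
      assume "\<not> q < Suc t"
      then have "Suc t * q \<le> q * q"
        by (intro mult_right_mono) auto
      then show False
        using nt r n by simp
    qed
    then have tr: "t - r > 0" "r \<le> t"
      using r by auto
    \<comment> \<open>\<open>t\<close> copies of \<open>b + s = q m\<close>, of which \<open>r\<close> are raised to \<open>a + s = (q + 1) m\<close>.\<close>
    have "r * (a + s) = r * (b + s) + r * m"
      using ab(3) by (simp add: m_def add_mult_distrib2)
    then have "(t - r) * (b + s) + r * (a + s) = ((t - r) + r) * (b + s) + r * m"
      by (simp only: add_mult_distrib add.assoc)
    then have "(t - r) * (b + s) + r * (a + s) = t * (b + s) + r * m"
      using tr(2) by simp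
    then have eq: "(t - r) * (b + s) + r * (a + s) = n * m"
      using nt q by (simp add: algebra_simps)
    have "(t - r) * (b + s) + r * (a + s) \<in> S"
      using add mult ab s tr by (cases "r = 0") auto
    then show ?thesis
      using eq by simp
  qed
  then show thesis
    using that[of "q * q + q"] by (simp add: m_def)
qed

section \<open>Lengths of chains\<close>

definition reach :: "'a::metric_space set \<Rightarrow> ('a \<Rightarrow> 'a) \<Rightarrow> real \<Rightarrow> nat \<Rightarrow> 'a \<Rightarrow> 'a \<Rightarrow> bool"
  where "reach X f \<delta> k x y \<longleftrightarrow> (\<exists>z. delta_chain X f \<delta> k z \<and> z 0 = x \<and> z k = y)"

lemma reach_in: "reach X f \<delta> k x y \<Longrightarrow> x \<in> X \<and> y \<in> X \<and> k > 0"
  by (auto simp: reach_def delta_chain_def)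

lemma reach_trans:
  assumes "reach X f \<delta> k x y" "reach X f \<delta> l y w"
  shows "reach X f \<delta> (k + l) x w"
proof -
  obtain u v where u: "delta_chain X f \<delta> k u" "u 0 = x" "u k = y"
    and v: "delta_chain X f \<delta> l v" "v 0 = y" "v l = w"
    using assms by (auto simp: reach_def)
  define z where "z i = (if i \<le> k then u i else v (i - k))" for i
  have "dist (f (z i)) (z (Suc i)) \<le> \<delta>" if "i < k + l" for i
  proof (cases "i < k")
    case False
    then have "z i = v (i - k)" "z (Suc i) = v (Suc (i - k))"
      using u v by (auto simp: z_def Suc_diff_le)
    then show ?thesis
      using v(1) that False by (simp add: delta_chain_def)
  qed (use u in \<open>auto simp: z_def delta_chain_def\<close>)
  moreover have "z i \<in> X" if "i \<le> k + l" for i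
    using u v that by (auto simp: z_def delta_chain_def)
  ultimately have "delta_chain X f \<delta> (k + l) z"
    using u by (auto simp: delta_chain_def)
  moreover have "z 0 = x" "z (k + l) = w"
    using u v by (auto simp: z_def delta_chain_def)
  ultimately show ?thesis
    by (auto simp: reach_def)
qed

lemma reach_perturb_end:
  assumes "reach X f \<delta> k x y" "w \<in> X" "dist y w \<le> \<eta>"
  shows "reach X f (\<delta> + \<eta>) k x w"
proof -
  obtain z where z: "delta_chain X f \<delta> k z" "z 0 = x" "z k = y"
    using assms by (auto simp: reach_def)
  have "\<eta> \<ge> 0"
    using assms(3) zero_le_dist[of y w] by linarith
  have "dist (f (z i)) ((z(k := w)) (Suc i)) \<le> \<delta> + \<eta>" if "i < k" for i
  proof -
    have *: "dist (f (z i)) (z (Suc i)) \<le> \<delta>"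
      using z that by (simp add: delta_chain_def)
    show ?thesis
    proof (cases "Suc i = k")
      case True
      then show ?thesis
        using * z assms dist_triangle[of "f (z i)" w y] by simp
    qed (use * \<open>\<eta> \<ge> 0\<close> in auto)
  qed
  then have "delta_chain X f (\<delta> + \<eta>) k (z(k := w))"
    using z assms by (auto simp: delta_chain_def)
  then show ?thesis
    using z unfolding reach_def
    by (intro exI[of _ "z(k := w)"]) (auto simp: delta_chain_def)
qed

lemma reach_mono: "reach X f \<delta> k x y \<Longrightarrow> \<delta> \<le> \<eta> \<Longrightarrow> reach X f \<eta> k x y"
  by (fastforce simp: reach_def delta_chain_def)

lemma cycle_gcd_dvd: "reach X f \<delta> k x x \<Longrightarrow> cycle_gcd X f \<delta> dvd k"
  unfolding cycle_gcd_def reach_def delta_cycle_def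
  by (rule Gcd_dvd) (metis (mono_tags) mem_Collect_eq)

lemma chain_rel_delta_iff_reach:
  "(x, y) \<in> chain_rel_delta X f \<delta> \<longleftrightarrow> (\<exists>k. reach X f \<delta> k x y \<and> cycle_gcd X f \<delta> dvd k)"
  by (auto simp: chain_rel_delta_def reach_def)

locale chain_transitive_map =
  fixes X :: "'a::metric_space set" and f :: "'a \<Rightarrow> 'a"
  assumes maps: "f \<in> X \<rightarrow> X" and transitive: "chain_transitive X f"
begin

lemma funpow_in: "x \<in> X \<Longrightarrow> (f ^^ i) x \<in> X"
  by (induction i) (use maps in auto)

lemma ex_reach:
  assumes "x \<in> X" "y \<in> X" "\<delta> > 0"
  obtains k where "reach X f \<delta> k x y"
  using transitive assms unfolding chain_transitive_def reach_def by meson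

lemma reach_step: "x \<in> X \<Longrightarrow> \<delta> > 0 \<Longrightarrow> reach X f \<delta> 1 x (f x)"
  using maps unfolding reach_def delta_chain_def
  by (intro exI[of _ "\<lambda>i. if i = 0 then x else f x"]) auto

lemma reach_funpow:
  assumes "x \<in> X" "\<delta> > 0" "k > 0"
  shows "reach X f \<delta> k x ((f ^^ k) x)"
  using assms(3)
proof (induction k rule: nat_induct_non_zero)
  case (Suc n)
  then show ?case
    using reach_trans[OF Suc(2) reach_step] funpow_in assms by simp
qed (use reach_step assms in simp)

text \<open>
  Closing up with a chain from \<open>y\<close> back to \<open>x\<close> turns every chain from \<open>x\<close> to \<open>y\<close> into a cycle, so
  any single chain decides whether the points are related.
\<close>

lemma chain_rel_delta_iff_dvd:
  assumes "reach X f \<delta> k x y" "\<delta> > 0"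
  shows "(x, y) \<in> chain_rel_delta X f \<delta> \<longleftrightarrow> cycle_gcd X f \<delta> dvd k"
proof -
  obtain l where l: "reach X f \<delta> l y x"
    using ex_reach assms reach_in by metis
  have "cycle_gcd X f \<delta> dvd j + l" if "reach X f \<delta> j x y" for j
    using cycle_gcd_dvd reach_trans[OF that l] by blast
  then have "cycle_gcd X f \<delta> dvd k" if "reach X f \<delta> j x y" "cycle_gcd X f \<delta> dvd j" for j
    using that assms(1) by (metis dvd_add_left_iff dvd_add_right_iff)
  then show ?thesis
    using assms by (auto simp: chain_rel_delta_iff_reach)
qed

lemma chain_rel_delta_in: "(x, y) \<in> chain_rel_delta X f \<delta> \<Longrightarrow> x \<in> X \<and> y \<in> X"
  by (auto simp: chain_rel_delta_iff_reach dest: reach_in)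

lemma chain_rel_delta_trans:
  "(x, y) \<in> chain_rel_delta X f \<delta> \<Longrightarrow> (y, w) \<in> chain_rel_delta X f \<delta>
    \<Longrightarrow> (x, w) \<in> chain_rel_delta X f \<delta>"
  by (meson chain_rel_delta_iff_reach dvd_add reach_trans)

lemma chain_rel_delta_sym:
  assumes "(x, y) \<in> chain_rel_delta X f \<delta>" "\<delta> > 0"
  shows "(y, x) \<in> chain_rel_delta X f \<delta>"
proof -
  obtain k where k: "reach X f \<delta> k x y" "cycle_gcd X f \<delta> dvd k"
    using assms by (auto simp: chain_rel_delta_iff_reach)
  obtain l where l: "reach X f \<delta> l y x"
    using ex_reach assms k reach_in by metis
  have "cycle_gcd X f \<delta> dvd l"
    using cycle_gcd_dvd[OF reach_trans[OF k(1) l]] k(2) by (simp add: dvd_add_right_iff)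
  then show ?thesis
    using l by (auto simp: chain_rel_delta_iff_reach)
qed

text \<open>
  Moving the end of a \<open>\<delta>/2\<close>-cycle at \<open>x\<close> to \<open>y\<close> gives a \<open>\<delta>\<close>-chain whose length is that of a
  \<open>\<delta>\<close>-cycle.
\<close>

lemma close_imp_chain_rel_delta:
  assumes "x \<in> X" "y \<in> X" "\<delta> > 0" "dist x y \<le> \<delta> / 2"
  shows "(x, y) \<in> chain_rel_delta X f \<delta>"
proof -
  obtain k where k: "reach X f (\<delta> / 2) k x x"
    using ex_reach[of x x "\<delta> / 2"] assms by auto
  have "reach X f \<delta> k x y"
    using reach_perturb_end[OF k assms(2,4)] by simp
  moreover have "cycle_gcd X f \<delta> dvd k"
    using cycle_gcd_dvd[OF reach_mono[OF k]] assms(3) by simp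
  ultimately show ?thesis
    by (auto simp: chain_rel_delta_iff_reach)
qed

text \<open>
  A chain from \<open>x\<close> to \<open>f y\<close> can be obtained either through \<open>f x\<close> or through \<open>y\<close>; in both ways the
  step of \<open>f\<close> contributes one to the length.
\<close>

lemma chain_rel_delta_image_iff:
  assumes "x \<in> X" "y \<in> X" "\<delta> > 0"
  shows "(f x, f y) \<in> chain_rel_delta X f \<delta> \<longleftrightarrow> (x, y) \<in> chain_rel_delta X f \<delta>"
proof -
  have fX: "f x \<in> X" "f y \<in> X"
    using maps assms by auto
  obtain k where k: "reach X f \<delta> k x y"
    using ex_reach assms by blast
  obtain l where l: "reach X f \<delta> l (f x) (f y)"
    using ex_reach assms fX by blast
  obtain r where r: "reach X f \<delta> r (f y) x"
    using ex_reach assms fX by blast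
  have "cycle_gcd X f \<delta> dvd k + (1 + r)" "cycle_gcd X f \<delta> dvd l + (1 + r)"
    using cycle_gcd_dvd[OF reach_trans[OF k reach_trans[OF reach_step[OF assms(2,3)] r]]]
      cycle_gcd_dvd[OF reach_trans[OF l reach_trans[OF r reach_step[OF assms(1,3)]]]]
    by (simp_all add: ac_simps)
  then have "cycle_gcd X f \<delta> dvd k \<longleftrightarrow> cycle_gcd X f \<delta> dvd l"
    by (metis dvd_add_left_iff dvd_add_right_iff)
  then show ?thesis
    using chain_rel_delta_iff_dvd k l assms by blast
qed

lemma chain_rel_delta_funpow_iff:
  assumes "x \<in> X" "y \<in> X" "\<delta> > 0"
  shows "((f ^^ i) x, (f ^^ i) y) \<in> chain_rel_delta X f \<delta> \<longleftrightarrow> (x, y) \<in> chain_rel_delta X f \<delta>"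
  by (induction i) (use chain_rel_delta_image_iff funpow_in assms in auto)

section \<open>Chains of prescribed length\<close>

text \<open>
  A cycle elsewhere can be inserted into a cycle at \<open>x\<close> that passes through it; its length is the
  difference of the lengths of the two cycles at \<open>x\<close>.
\<close>

lemma cycle_gcd_at_point:
  assumes "x \<in> X" "\<delta> > 0"
  shows "Gcd {k. reach X f \<delta> k x x} = cycle_gcd X f \<delta>"
proof (rule dvd_antisym)
  show "cycle_gcd X f \<delta> dvd Gcd {k. reach X f \<delta> k x x}"
    by (rule Gcd_greatest) (auto intro: cycle_gcd_dvd)
  show "Gcd {k. reach X f \<delta> k x x} dvd cycle_gcd X f \<delta>"
    unfolding cycle_gcd_def
  proof (rule Gcd_greatest, clarify)
    fix k z assume "delta_cycle X f \<delta> k z"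
    then have k: "reach X f \<delta> k (z 0) (z 0)"
      by (auto simp: delta_cycle_def reach_def)
    obtain a where a: "reach X f \<delta> a x (z 0)"
      using ex_reach assms k reach_in by metis
    obtain b where b: "reach X f \<delta> b (z 0) x"
      using ex_reach assms k reach_in by metis
    have "Gcd {k. reach X f \<delta> k x x} dvd a + b" "Gcd {k. reach X f \<delta> k x x} dvd k + (a + b)"
      using reach_trans[OF a b] reach_trans[OF a reach_trans[OF k b]]
      by (auto intro!: Gcd_dvd simp: ac_simps)
    then show "Gcd {k. reach X f \<delta> k x x} dvd k"
      by (simp add: dvd_add_left_iff)
  qed
qed

lemma cycle_gcd_pos:
  assumes "x \<in> X" "\<delta> > 0"
  shows "cycle_gcd X f \<delta> > 0"
proof -
  obtain k where k: "reach X f \<delta> k x x"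
    using ex_reach assms by blast
  then show ?thesis
    using cycle_gcd_dvd[OF k] reach_in[OF k] by (auto intro!: Nat.gr0I)
qed

lemma reach_large_multiples:
  assumes "(x, y) \<in> chain_rel_delta X f \<delta>" "\<delta> > 0"
  obtains N where "\<And>n. n \<ge> N \<Longrightarrow> reach X f \<delta> (n * cycle_gcd X f \<delta>) x y"
proof -
  have x: "x \<in> X"
    using assms chain_rel_delta_in by blast
  obtain s where "reach X f \<delta> s x x"
    using ex_reach x assms by blast
  then obtain N where "\<And>n. n \<ge> N \<Longrightarrow>
      n * Gcd {k. reach X f \<delta> k x x} \<in> {k. reach X f \<delta> k x x}"
    using numerical_semigroup_cofinite[of "{k. reach X f \<delta> k x x}" s]
      reach_trans[of X f \<delta> _ x x _ x] reach_in[of X f \<delta> s x x] by blast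
  then have N: "reach X f \<delta> (n * cycle_gcd X f \<delta>) x x" if "n \<ge> N" for n
    using cycle_gcd_at_point[OF x assms(2)] that by simp
  obtain q where q: "reach X f \<delta> (q * cycle_gcd X f \<delta>) x y"
    using assms by (metis chain_rel_delta_iff_reach dvd_def mult.commute)
  have "reach X f \<delta> (n * cycle_gcd X f \<delta>) x y" if "n \<ge> N + q" for n
    using reach_trans[OF N[of "n - q"] q] that by (simp flip: add_mult_distrib)
  then show thesis
    using that by blast
qed

text \<open>
  The difficulty is that the target depends on the length of the chain. Every accumulation point
  \<open>z\<close> of the points \<open>f\<^sup>j\<^sup>m(x)\<close> is \<open>\<delta>/2\<close>-related to \<open>x\<close>, hence reached from \<open>y\<close> by \<open>\<delta>/2\<close>-chains of
  all large lengths \<open>j m\<close>; for suitable \<open>j\<close> the end of such a chain can be moved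
  from \<open>z\<close> to \<open>f\<^sup>j\<^sup>m(x)\<close>.
\<close>

lemma synchronised_chain:
  assumes "compact X" "\<delta> > 0" "(y, x) \<in> chain_rel_delta X f (\<delta> / 2)"
  obtains k where "reach X f \<delta> k y ((f ^^ k) x)"
proof -
  define \<eta> where "\<eta> = \<delta> / 2"
  define m where "m = cycle_gcd X f \<eta>"
  have \<eta>: "\<eta> > 0" and yx: "(y, x) \<in> chain_rel_delta X f \<eta>"
    using assms by (auto simp: \<eta>_def)
  have x: "x \<in> X"
    using yx chain_rel_delta_in by blast
  have m: "m > 0"
    using cycle_gcd_pos x \<eta> by (simp add: m_def)
  obtain z r where z: "z \<in> X" and r: "strict_mono r"
    and lim: "((\<lambda>j. (f ^^ (j * m)) x) \<circ> r) \<longlonglongrightarrow> z"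
    using assms(1) funpow_in[OF x] unfolding compact_def by (metis (no_types, lifting))
  have "eventually (\<lambda>i. dist ((f ^^ (r i * m)) x) z < \<eta> / 2) sequentially"
    using tendstoD[OF lim, of "\<eta> / 2"] \<eta> by (simp add: o_def)
  then obtain M where M: "\<And>i. i \<ge> M \<Longrightarrow> dist ((f ^^ (r i * m)) x) z < \<eta> / 2"
    by (auto simp: eventually_sequentially)
  have big: "i \<le> r i" for i
    using r by (rule seq_suble)
  have "(x, z) \<in> chain_rel_delta X f \<eta>"
  proof (rule chain_rel_delta_trans)
    define i where "i = Suc M"
    have "reach X f \<eta> (r i * m) x ((f ^^ (r i * m)) x)"
      using reach_funpow x \<eta> m big[of i] by (simp add: i_def)
    then show "(x, (f ^^ (r i * m)) x) \<in> chain_rel_delta X f \<eta>"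
      using chain_rel_delta_iff_dvd \<eta> by (simp add: m_def)
    show "((f ^^ (r i * m)) x, z) \<in> chain_rel_delta X f \<eta>"
      using close_imp_chain_rel_delta[OF funpow_in[OF x] z \<eta>] M[of i]
      by (simp add: i_def less_imp_le)
  qed
  then obtain N where N: "\<And>n. n \<ge> N \<Longrightarrow> reach X f \<eta> (n * m) y z"
    using reach_large_multiples[OF chain_rel_delta_trans[OF yx] \<eta>] m_def by metis
  define j where "j = r (max M N)"
  have "reach X f \<eta> (j * m) y z"
    using N big[of "max M N"] by (simp add: j_def)
  moreover have "dist z ((f ^^ (j * m)) x) \<le> \<eta>"
    using M[of "max M N"] \<eta> by (simp add: j_def dist_commute)
  ultimately have "reach X f (\<eta> + \<eta>) (j * m) y ((f ^^ (j * m)) x)"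
    using reach_perturb_end funpow_in[OF x] by blast
  then show thesis
    using that by (simp add: \<eta>_def)
qed

section \<open>The class relation\<close>

lemma chain_rel_refl: "x \<in> X \<Longrightarrow> (x, x) \<in> chain_rel X f"
  using close_imp_chain_rel_delta by (auto simp: chain_rel_def)

lemma chain_rel_sym: "(x, y) \<in> chain_rel X f \<Longrightarrow> (y, x) \<in> chain_rel X f"
  using chain_rel_delta_sym by (auto simp: chain_rel_def)

lemma chain_rel_trans:
  "(x, y) \<in> chain_rel X f \<Longrightarrow> (y, w) \<in> chain_rel X f \<Longrightarrow> (x, w) \<in> chain_rel X f"
  using chain_rel_delta_trans by (fastforce simp: chain_rel_def)

lemma chain_rel_in: "(x, y) \<in> chain_rel X f \<Longrightarrow> x \<in> X \<and> y \<in> X"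
  using chain_rel_delta_in by (auto simp: chain_rel_def intro: zero_less_one)

lemma chain_rel_image: "(x, y) \<in> chain_rel X f \<Longrightarrow> (f x, f y) \<in> chain_rel X f"
  using chain_rel_delta_image_iff chain_rel_in by (auto simp: chain_rel_def)

lemma chain_rel_limit:
  assumes rel: "\<And>n::nat. (x, p n) \<in> chain_rel X f" and "p \<longlonglongrightarrow> q" "q \<in> X"
  shows "(x, q) \<in> chain_rel X f"
  unfolding chain_rel_def
proof clarify
  fix \<delta> :: real assume \<delta>: "\<delta> > 0"
  obtain n where "dist (p n) q < \<delta> / 2"
    using tendstoD[OF assms(2), of "\<delta> / 2"] \<delta> by (auto simp: eventually_sequentially)
  then have "(p n, q) \<in> chain_rel_delta X f \<delta>"
    using close_imp_chain_rel_delta[of "p n" q \<delta>] rel chain_rel_in assms(3) \<delta> less_imp_le by blast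
  then show "(x, q) \<in> chain_rel_delta X f \<delta>"
    using rel[of n] \<delta> chain_rel_delta_trans by (auto simp: chain_rel_def)
qed

lemma chain_class_in_hyperspace:
  assumes "compact X" "x \<in> X"
  shows "chain_class X f x \<in> hyperspace X"
proof -
  have sub: "chain_class X f x \<subseteq> X"
    using chain_rel_in by (auto simp: chain_class_def)
  have "q \<in> chain_class X f x" if p: "\<And>n. p n \<in> chain_class X f x" "p \<longlonglongrightarrow> q" for p q
  proof -
    have "q \<in> X"
      using closed_sequentially[OF compact_imp_closed[OF assms(1)] _ p(2)] p(1) sub by blast
    then show ?thesis
      using chain_rel_limit[of x p q] p by (simp add: chain_class_def)
  qed
  then have "closed (chain_class X f x)"
    unfolding closed_sequential_limits by blast
  then have "closedin (top_of_set X) (chain_class X f x)"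
    using closed_subset sub by blast
  then show ?thesis
    using chain_rel_refl assms(2) by (auto simp: hyperspace_def chain_class_def)
qed

lemma asymptotic_imp_related:
  assumes p: "p \<in> X" and q: "q \<in> X"
    and rel: "eventually (\<lambda>i. ((f ^^ i) q, x i) \<in> chain_rel X f) sequentially"
    and lim: "(\<lambda>i. dist ((f ^^ i) p) (x i)) \<longlonglongrightarrow> 0"
  shows "(q, p) \<in> chain_rel X f"
  unfolding chain_rel_def
proof clarify
  fix \<delta> :: real assume \<delta>: "\<delta> > 0"
  have "eventually (\<lambda>i. dist ((f ^^ i) p) (x i) < \<delta> / 2) sequentially"
    using order_tendstoD(2)[OF lim, of "\<delta> / 2"] \<delta> by simp
  then have "eventually (\<lambda>i. ((f ^^ i) q, x i) \<in> chain_rel X f \<and>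
      dist ((f ^^ i) p) (x i) < \<delta> / 2) sequentially"
    using rel by (rule eventually_conj[rotated])
  then obtain i where i: "((f ^^ i) q, x i) \<in> chain_rel X f" "dist ((f ^^ i) p) (x i) < \<delta> / 2"
    by (auto simp: eventually_sequentially)
  have "(x i, (f ^^ i) p) \<in> chain_rel_delta X f \<delta>"
    using close_imp_chain_rel_delta[of "x i" "(f ^^ i) p" \<delta>] i chain_rel_in funpow_in[OF p] \<delta>
    by (simp add: dist_commute)
  moreover have "((f ^^ i) q, x i) \<in> chain_rel_delta X f \<delta>"
    using i \<delta> by (simp add: chain_rel_def)
  ultimately show "(q, p) \<in> chain_rel_delta X f \<delta>"
    using chain_rel_delta_funpow_iff p q \<delta> chain_rel_delta_trans by blast
qed

section \<open>Shadowing along the classes\<close>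

lemma class_pseudo_orbit_related:
  assumes "class_pseudo_orbit X f \<delta> x"
  shows "((f ^^ i) (x 0), x i) \<in> chain_rel X f"
proof (induction i)
  case (Suc i)
  then show ?case
    using chain_rel_image chain_rel_trans assms by (fastforce simp: class_pseudo_orbit_def)
qed (use assms chain_rel_refl in \<open>auto simp: class_pseudo_orbit_def\<close>)

lemma limit_shadowing_along_classes:
  assumes "class_pseudo_orbit X f \<delta> x" "limit_shadowed f \<epsilon> x p" "p \<in> X"
  shows "(x 0, p) \<in> chain_rel X f"
  using assms class_pseudo_orbit_related[OF assms(1)]
  by (intro asymptotic_imp_related[where x = x])
    (auto simp: limit_shadowed_def class_pseudo_orbit_def)

definition follow_orbit :: "nat \<Rightarrow> (nat \<Rightarrow> 'a) \<Rightarrow> nat \<Rightarrow> 'a"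
  where "follow_orbit n x i = (if i \<le> n then x i else (f ^^ (i - n)) (x n))"

lemma follow_orbit_Suc: "i \<ge> n \<Longrightarrow> follow_orbit n x (Suc i) = f (follow_orbit n x i)"
  by (auto simp: follow_orbit_def Suc_diff_le)

lemma limit_pseudo_orbit_follow_orbit:
  assumes "\<And>i. i \<le> n \<Longrightarrow> x i \<in> X" "\<And>i. i < n \<Longrightarrow> dist (f (x i)) (x (Suc i)) \<le> \<delta>" "\<delta> > 0"
  shows "limit_pseudo_orbit X f \<delta> (follow_orbit n x)"
proof -
  have "dist (f (follow_orbit n x i)) (follow_orbit n x (Suc i)) \<le> \<delta>" for i
    using assms follow_orbit_Suc[of n i x] by (cases "i < n") (auto simp: follow_orbit_def)
  moreover have "eventually (\<lambda>i. dist (f (follow_orbit n x i)) (follow_orbit n x (Suc i)) = 0)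
      sequentially"
    using follow_orbit_Suc[of n _ x] unfolding eventually_sequentially
    by (intro exI[of _ n]) simp
  ultimately show ?thesis
    using assms(1) funpow_in
    by (auto simp: limit_pseudo_orbit_def follow_orbit_def[of n x] tendsto_eventually)
qed

lemma class_pseudo_orbit_follow_orbit:
  assumes "class_pseudo_orbit X f \<delta> x" "\<delta> > 0"
  shows "class_pseudo_orbit X f \<delta> (follow_orbit n x)"
proof -
  have "limit_pseudo_orbit X f \<delta> (follow_orbit n x)"
    using assms by (intro limit_pseudo_orbit_follow_orbit) (auto simp: class_pseudo_orbit_def)
  moreover have "(f (follow_orbit n x i), follow_orbit n x (Suc i)) \<in> chain_rel X f" for i
  proof (cases "i < n")
    case False
    have "f (follow_orbit n x i) \<in> X"
      using calculation maps by (auto simp: limit_pseudo_orbit_def)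
    then show ?thesis
      using False follow_orbit_Suc[of n i x] chain_rel_refl by simp
  qed (use assms in \<open>auto simp: class_pseudo_orbit_def follow_orbit_def\<close>)
  ultimately show ?thesis
    by (simp add: class_pseudo_orbit_def limit_pseudo_orbit_def)
qed

lemma continuous_on_funpow:
  assumes "continuous_on X f"
  shows "continuous_on X (f ^^ i)"
proof (induction i)
  case (Suc i)
  have "(f ^^ i) ` X \<subseteq> X"
    using funpow_in by auto
  then show ?case
    using continuous_on_compose[OF Suc continuous_on_subset[OF assms]] by simp
qed simp

theorem s_limit_shadowing_imp_shadowing_along_classes:
  assumes "compact X" "continuous_on X f" "s_limit_shadowing X f"
  shows "shadowing_along_classes X f"
  unfolding shadowing_along_classes_def
proof (intro allI impI)
  fix \<epsilon> :: real assume "\<epsilon> > 0"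
  then obtain \<delta> where \<delta>: "\<delta> > 0"
    and sh: "\<And>x. limit_pseudo_orbit X f \<delta> x \<Longrightarrow> \<exists>p\<in>X. limit_shadowed f \<epsilon> x p"
    using assms(3) by (auto simp: s_limit_shadowing_def)
  show "\<exists>\<delta>>0. \<forall>x. class_pseudo_orbit X f \<delta> x \<longrightarrow>
      (\<exists>p\<in>X. (x 0, p) \<in> chain_rel X f \<and> (\<forall>i. dist ((f ^^ i) p) (x i) \<le> \<epsilon>))"
  proof (intro exI[of _ \<delta>] conjI allI impI \<delta>)
    fix x assume x: "class_pseudo_orbit X f \<delta> x"
    have "\<exists>p\<in>X. limit_shadowed f \<epsilon> (follow_orbit n x) p" for n
      using x \<delta> by (intro sh limit_pseudo_orbit_follow_orbit) (auto simp: class_pseudo_orbit_def)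
    then obtain p where p: "\<And>n. p n \<in> X" "\<And>n. limit_shadowed f \<epsilon> (follow_orbit n x) (p n)"
      by metis
    have rel: "(x 0, p n) \<in> chain_rel X f" for n
      using limit_shadowing_along_classes[OF class_pseudo_orbit_follow_orbit[OF x \<delta>] p(2,1)]
      by (simp add: follow_orbit_def)
    have close: "dist ((f ^^ i) (p n)) (x i) \<le> \<epsilon>" if "i \<le> n" for i n
    proof -
      have "dist ((f ^^ i) (p n)) (follow_orbit n x i) \<le> \<epsilon>"
        using p(2)[of n] by (simp add: limit_shadowed_def)
      then show ?thesis
        using that by (simp add: follow_orbit_def)
    qed
    obtain q r where q: "q \<in> X" and r: "strict_mono r" and lim: "(p \<circ> r) \<longlonglongrightarrow> q"
      using assms(1) p(1) unfolding compact_def by metis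
    have "dist ((f ^^ i) q) (x i) \<le> \<epsilon>" for i
    proof (rule tendsto_upperbound)
      have "(\<lambda>n. (f ^^ i) ((p \<circ> r) n)) \<longlonglongrightarrow> (f ^^ i) q"
        using continuous_on_tendsto_compose[OF continuous_on_funpow[OF assms(2)] lim q] p(1)
        by simp
      then show "(\<lambda>n. dist ((f ^^ i) ((p \<circ> r) n)) (x i)) \<longlonglongrightarrow> dist ((f ^^ i) q) (x i)"
        by (intro tendsto_intros)
      have "dist ((f ^^ i) ((p \<circ> r) n)) (x i) \<le> \<epsilon>" if "n \<ge> i" for n
        using close[of i "r n"] that seq_suble[OF r, of n] by simp
      then show "eventually (\<lambda>n. dist ((f ^^ i) ((p \<circ> r) n)) (x i) \<le> \<epsilon>) sequentially"
        by (auto simp: eventually_sequentially)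
    qed simp
    moreover have "(x 0, q) \<in> chain_rel X f"
      using chain_rel_limit[OF _ lim q] rel by simp
    ultimately show "\<exists>p\<in>X. (x 0, p) \<in> chain_rel X f \<and> (\<forall>i. dist ((f ^^ i) p) (x i) \<le> \<epsilon>)"
      using q by blast
  qed
qed

section \<open>Continuity of the class map\<close>

text \<open>
  This is lower semicontinuity of the class map. As \<open>\<rho>\<close> does not depend on the points, \<open>x\<close> and \<open>x'\<close>
  can be exchanged, so the Hausdorff distance between the two classes is bounded as well.
\<close>

lemma chain_class_lower_semicontinuous:
  assumes "compact X" "s_limit_shadowing X f" "\<epsilon> > 0"
  obtains \<rho> where "\<rho> > 0"
    "\<And>x x' y. \<lbrakk>(x, y) \<in> chain_rel X f; x' \<in> X; dist x x' \<le> \<rho>\<rbrakk>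
      \<Longrightarrow> \<exists>y'. (x', y') \<in> chain_rel X f \<and> dist y y' \<le> \<epsilon>"
proof -
  obtain \<delta> where \<delta>: "\<delta> > 0"
    and sh: "\<And>x. limit_pseudo_orbit X f \<delta> x \<Longrightarrow> \<exists>p\<in>X. limit_shadowed f \<epsilon> x p"
    using assms(2,3) by (auto simp: s_limit_shadowing_def)
  \<comment> \<open>Points at distance \<open>\<delta>/4\<close> are \<open>\<delta>/2\<close>-related, which is what a synchronised \<open>\<delta>\<close>-chain needs.\<close>
  have "\<exists>y'. (x', y') \<in> chain_rel X f \<and> dist y y' \<le> \<epsilon>"
    if xy: "(x, y) \<in> chain_rel X f" and x': "x' \<in> X" and close: "dist x x' \<le> \<delta> / 4" for x x' y
  proof -
    have "(y, x) \<in> chain_rel_delta X f (\<delta> / 2)"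
      using chain_rel_sym[OF xy] \<delta> by (simp add: chain_rel_def)
    moreover have "(x, x') \<in> chain_rel_delta X f (\<delta> / 2)"
      using close_imp_chain_rel_delta[of x x' "\<delta> / 2"] chain_rel_in[OF xy] x' close \<delta> by simp
    ultimately obtain k where "reach X f \<delta> k y ((f ^^ k) x')"
      using synchronised_chain[OF assms(1) \<delta>] chain_rel_delta_trans by blast
    then obtain z where z: "delta_chain X f \<delta> k z" "z 0 = y" "z k = (f ^^ k) x'"
      by (auto simp: reach_def)
    have "limit_pseudo_orbit X f \<delta> (follow_orbit k z)"
      using z \<delta> by (intro limit_pseudo_orbit_follow_orbit) (auto simp: delta_chain_def)
    then obtain p where p: "p \<in> X" "limit_shadowed f \<epsilon> (follow_orbit k z) p"
      using sh by blast
    have "follow_orbit k z i = (f ^^ i) x'" if "i \<ge> k" for i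
      using that by (induction i rule: dec_induct)
        (auto simp: follow_orbit_Suc follow_orbit_def[of k z k] z)
    then have "eventually (\<lambda>i. ((f ^^ i) x', follow_orbit k z i) \<in> chain_rel X f) sequentially"
      using chain_rel_refl[OF funpow_in[OF x']] unfolding eventually_sequentially
      by (intro exI[of _ k]) simp
    then have "(x', p) \<in> chain_rel X f"
      using asymptotic_imp_related p x' by (auto simp: limit_shadowed_def)
    moreover have "dist ((f ^^ 0) p) (follow_orbit k z 0) \<le> \<epsilon>"
      using p(2) by (simp only: limit_shadowed_def)
    then have "dist y p \<le> \<epsilon>"
      using z(2) by (simp add: follow_orbit_def dist_commute)
    ultimately show ?thesis
      by blast
  qed
  then show thesis
    using that[of "\<delta> / 4"] \<delta> by auto
qed

theorem s_limit_shadowing_imp_continuous_chain_class: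
  assumes "compact X" "s_limit_shadowing X f"
  shows "continuous_map (top_of_set X)
    (Metric_space.mtopology (hyperspace X) (hausdorff_dist X)) (chain_class X f)"
proof -
  interpret H: Metric_space "hyperspace X" "hausdorff_dist X"
    by (rule Metric_space_hausdorff_dist[OF assms(1)])
  have "\<exists>U. openin (top_of_set X) U \<and> x \<in> U \<and>
      (\<forall>x'\<in>U. chain_class X f x' \<in> H.mball (chain_class X f x) e)"
    if x: "x \<in> X" and e: "e > 0" for x e
  proof -
    obtain \<rho> where \<rho>: "\<rho> > 0"
      and lsc: "\<And>x x' y. \<lbrakk>(x, y) \<in> chain_rel X f; x' \<in> X; dist x x' \<le> \<rho>\<rbrakk>
        \<Longrightarrow> \<exists>y'. (x', y') \<in> chain_rel X f \<and> dist y y' \<le> e / 3"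
      using chain_class_lower_semicontinuous[OF assms, of "e / 3"] e by auto
    have nbhd: "chain_class X f u \<subseteq> set_nbhd X (e / 2) (chain_class X f v)"
      if uv: "v \<in> X" "dist u v \<le> \<rho>" for u v
    proof
      fix y assume y: "y \<in> chain_class X f u"
      then have uy: "(u, y) \<in> chain_rel X f"
        by (simp add: chain_class_def)
      obtain y' where "y' \<in> chain_class X f v" "dist y y' \<le> e / 3"
        using lsc[OF uy uv] by (auto simp: chain_class_def)
      then have "infdist y (chain_class X f v) < e / 2"
        using infdist_le[of y' "chain_class X f v" y] e by linarith
      then show "y \<in> set_nbhd X (e / 2) (chain_class X f v)"
        using chain_rel_in[OF uy] by (simp add: set_nbhd_def)
    qed
    have "chain_class X f x' \<in> H.mball (chain_class X f x) e" if x': "x' \<in> X \<inter> ball x \<rho>" for x'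
    proof -
      have cl: "chain_class X f x \<in> hyperspace X" "chain_class X f x' \<in> hyperspace X"
        using chain_class_in_hyperspace assms(1) x x' by auto
      have "hausdorff_dist X (chain_class X f x) (chain_class X f x') \<le> e / 2"
        unfolding hausdorff_dist_def if_P[OF conjI[OF cl]]
        using nbhd[of x' x] nbhd[of x x'] x x' e
        by (intro cInf_lower bdd_belowI[of _ 0]) (auto simp: dist_commute)
      then show ?thesis
        using cl e by (simp add: H.mball_def)
    qed
    moreover have "openin (top_of_set X) (X \<inter> ball x \<rho>)"
      by (simp add: openin_open_Int)
    ultimately show ?thesis
      using x \<rho> by (intro exI[of _ "X \<inter> ball x \<rho>"]) auto
  qed
  then show ?thesis
    by (simp add: H.continuous_map_to_metric)
qed

end

theorem proposition1p1:
  fixes X :: "'a::metric_space set" and f :: "'a \<Rightarrow> 'a"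
  assumes "compact X" and "continuous_on X f" and "f \<in> X \<rightarrow> X"
    and "chain_transitive X f" and "s_limit_shadowing X f"
  shows "shadowing_along_classes X f \<and>
    continuous_map (top_of_set X) (Metric_space.mtopology (hyperspace X) (hausdorff_dist X))
      (chain_class X f)"
proof -
  interpret chain_transitive_map X f
    using assms(3,4) by unfold_locales
  show ?thesis
    using s_limit_shadowing_imp_shadowing_along_classes[OF assms(1,2,5)]
      s_limit_shadowing_imp_continuous_chain_class[OF assms(1,5)] by blast
qed

end
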